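(* Let $(S,G)$ be an oriented combinatorial surface with set of faces $\mathcal{F}$, and let $\mathbf{F}$ be a combinatorial vector field (CVF) on $(S,G)$. Then $$\oint_{\partial S} \mathbf{F} = \oint_{S} \operatorname{whirl} \mathbf{F},$$ that is, $$\sum_{e\subset\partial S}\epsilon(e,\mathbf{F})\,\mathbf{F}(e)=\sum_{\sigma\in\mathcal{F}}\operatorname{whirl}\mathbf{F}(\sigma),$$ where the left-hand sum is over the edges $e$ of $G$ contained in $\partial S$, each with the orientation induced by the orientation of $(S,G)$.
   Context: A combinatorial surface $(S,G)$ consists of a compact smooth surface $S \subset \mathbb{R}^n$ (possibly with boundary) and a graph $G$ embedded in $S$. The graph consists of finitely many vertices $\mathcal{V}$ (points of $S$); finitely many edges $\mathcal{E}$, each an embedded C$^1$ curve with endpoints on vertices (loops are allowed; edges meet only at vertices); and faces $\mathcal{F}$, each the closure of a component of $S - (\bigcup \mathcal{V} \cup \bigcup \mathcal{E})$. It is required that: each face is homeomorphic to a disc; each vertex is the endpoint of at least one edge; $\partial S \subset \bigcup \mathcal{E}$; each edge not contained in $\partial S$ lies in the boundary of two distinct faces. An orientation of an edge is a choice of direction along it; the edge points out of its source vertex and into its sink vertex. An orientation of a face $\sigma$ is a choice of orientation on each edge of $\partial\sigma$ such that the sink of each edge is the source of another edge in $\partial\sigma$ (if $\partial\sigma$ is a single loop edge, either orientation of it is allowed); these edge orientations are said to be induced by the orientation of $\sigma$. The combinatorial surface $(S,G)$ is oriented if each face is given an orientation such that whenever two faces $\sigma,\tau$ coincide along an edge $e$,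 the orientations of $\sigma$ and $\tau$ induce opposite orientations on $e$. The orientation of the edges in $\partial S$ induced by the orientation of $(S,G)$ is the one induced by the orientations of the faces adjacent to those edges. A combinatorial vector field (CVF) $\mathbf{F}$ is a choice of orientation on each edge together with a function $\mathbf{F}\colon\mathcal{E}\to\mathbb{R}$. For an oriented edge $e$, let $\epsilon(e,\mathbf{F})=+1$ if the orientation of $e$ agrees with the one given by $\mathbf{F}$ and $-1$ otherwise. The integral of $\mathbf{F}$ over a collection $E$ of oriented edges is $\oint_E\mathbf{F}=\sum_{e\in E}\epsilon(e,\mathbf{F})\mathbf{F}(e)$. The integral over $S$ of a function $f\colon\mathcal{F}\to\mathbb{R}$ is $\oint_S f=\sum_{\sigma\in\mathcal{F}}f(\sigma)$. For an oriented face $\sigma$, $\operatorname{whirl}\mathbf{F}(\sigma)=\oint_{\partial\sigma}\mathbf{F}=\sum_{e\subset\partial\sigma}\epsilon(e,\mathbf{F})\mathbf{F}(e)$, where the edges of $\partial\sigma$ carry the orientation induced by $\sigma$; on an oriented combinatorial surface each face carries the orientation given by that of $(S,G)$. *)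

theory Defs
  imports "HOL-Analysis.Analysis"
begin

section \<open>Smooth surfaces with boundary in Euclidean space\<close>

text \<open>Smoothness on an arbitrary subset, surfaces and their boundary follow Milnor: a map on a
  subset is smooth if it locally extends to a smooth map on an open set, and a surface is a set
  locally diffeomorphic to relatively open subsets of the closed half-plane.\<close>

primrec Ck_on :: "nat \<Rightarrow> 'a::real_normed_vector set \<Rightarrow> ('a \<Rightarrow> 'b::real_normed_vector) \<Rightarrow> bool" where
  "Ck_on 0 U f \<longleftrightarrow> continuous_on U f"
| "Ck_on (Suc k) U f \<longleftrightarrow> (\<forall>x\<in>U. f differentiable (at x)) \<and>
     (\<forall>v. Ck_on k U (\<lambda>x. frechet_derivative f (at x) v))"

definition smooth_on :: "'a::real_normed_vector set \<Rightarrow> ('a \<Rightarrow> 'b::real_normed_vector) \<Rightarrow> bool" where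
  "smooth_on X f \<longleftrightarrow> (\<forall>x\<in>X. \<exists>U g. open U \<and> x \<in> U \<and> (\<forall>k. Ck_on k U g) \<and> (\<forall>y\<in>U \<inter> X. g y = f y))"

definition half_plane :: "(real^2) set" where
  "half_plane = {x. 0 \<le> x $ 2}"

definition surface_chart ::
  "'a::euclidean_space set \<Rightarrow> 'a set \<Rightarrow> ('a \<Rightarrow> real^2) \<Rightarrow> bool" where
  "surface_chart S W \<phi> \<longleftrightarrow> openin (top_of_set S) W \<and> openin (top_of_set half_plane) (\<phi> ` W) \<and>
     (\<exists>\<psi>. homeomorphism W (\<phi> ` W) \<phi> \<psi> \<and> smooth_on W \<phi> \<and> smooth_on (\<phi> ` W) \<psi>)"

definition smooth_surface :: "'a::euclidean_space set \<Rightarrow> bool" where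
  "smooth_surface S \<longleftrightarrow> (\<forall>p\<in>S. \<exists>W \<phi>. surface_chart S W \<phi> \<and> p \<in> W)"

definition surface_boundary :: "'a::euclidean_space set \<Rightarrow> 'a set" where
  "surface_boundary S = {p. \<exists>W \<phi>. surface_chart S W \<phi> \<and> p \<in> W \<and> \<phi> p $ 2 = 0}"

text \<open>The boundary circle of a topological closed disc.\<close>

definition disc_boundary :: "'a::euclidean_space set \<Rightarrow> 'a set" where
  "disc_boundary \<sigma> = {p. \<exists>h g. homeomorphism (cball (0::real^2) 1) \<sigma> h g \<and> p \<in> h ` sphere 0 1}"


section \<open>Edges and their orientations\<close>

definition C1_embedded_curve :: "(real \<Rightarrow> 'a::euclidean_space) \<Rightarrow> bool" where
  "C1_embedded_curve \<gamma> \<longleftrightarrow> simple_path \<gamma> \<and>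
     (\<exists>D. continuous_on {0..1} D \<and>
       (\<forall>t\<in>{0..1}. (\<gamma> has_vector_derivative D t) (at t within {0..1}) \<and> D t \<noteq> 0))"

text \<open>Parametrizations of an edge \<open>e\<close> with endpoints in the vertex set \<open>V\<close>.  No vertex lies in the
  interior of an edge; in particular a loop is parametrized starting from its vertex.\<close>

definition edge_params :: "'a::euclidean_space set \<Rightarrow> 'a set \<Rightarrow> (real \<Rightarrow> 'a) set" where
  "edge_params V e = {\<gamma>. C1_embedded_curve \<gamma> \<and> path_image \<gamma> = e \<and>
     pathstart \<gamma> \<in> V \<and> pathfinish \<gamma> \<in> V \<and> \<gamma> ` {0<..<1} \<inter> V = {}}"

definition same_direction :: "(real \<Rightarrow> 'a) \<Rightarrow> (real \<Rightarrow> 'a) \<Rightarrow> bool" where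
  "same_direction \<gamma> \<delta> \<longleftrightarrow> (\<exists>h. strict_mono_on {0..1} h \<and> h ` {0..1} = {0..1::real} \<and>
     (\<forall>t\<in>{0..1}. \<delta> t = \<gamma> (h t)))"

text \<open>An orientation of an edge is a class of parametrizations under increasing
  reparametrization.  Source and sink alone would not distinguish the two directions of a loop.\<close>

type_synonym 'a edge_orientation = "(real \<Rightarrow> 'a) set"

definition edge_orientations ::
  "'a::euclidean_space set \<Rightarrow> 'a set \<Rightarrow> 'a edge_orientation set" where
  "edge_orientations V e = edge_params V e //
     {(\<gamma>, \<delta>). \<gamma> \<in> edge_params V e \<and> \<delta> \<in> edge_params V e \<and> same_direction \<gamma> \<delta>}"

definition source :: "'a::euclidean_space edge_orientation \<Rightarrow> 'a" where
  "source d = the_elem (pathstart ` d)"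

definition sink :: "'a::euclidean_space edge_orientation \<Rightarrow> 'a" where
  "sink d = the_elem (pathfinish ` d)"

definition opposite :: "'a::euclidean_space edge_orientation \<Rightarrow> 'a edge_orientation" where
  "opposite d = reversepath ` d"


section \<open>Combinatorial surfaces\<close>

record 'a surface_graph =
  surf :: "'a set"
  verts :: "'a set"
  edges :: "'a set set"

definition faces :: "'a::euclidean_space surface_graph \<Rightarrow> 'a set set" where
  "faces G = closure ` components (surf G - (verts G \<union> \<Union>(edges G)))"

definition face_edges :: "'a::euclidean_space surface_graph \<Rightarrow> 'a set \<Rightarrow> 'a set set" where
  "face_edges G \<sigma> = {e \<in> edges G. e \<subseteq> disc_boundary \<sigma>}"

definition boundary_edges :: "'a::euclidean_space surface_graph \<Rightarrow> 'a set set" where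
  "boundary_edges G = {e \<in> edges G. e \<subseteq> surface_boundary (surf G)}"

definition combinatorial_surface :: "'a::euclidean_space surface_graph \<Rightarrow> bool" where
  "combinatorial_surface G \<longleftrightarrow>
     compact (surf G) \<and> smooth_surface (surf G) \<and>
     finite (verts G) \<and> verts G \<subseteq> surf G \<and>
     finite (edges G) \<and>
     (\<forall>e\<in>edges G. e \<subseteq> surf G \<and> edge_params (verts G) e \<noteq> {}) \<and>
     (\<forall>e\<in>edges G. \<forall>e'\<in>edges G. e \<noteq> e' \<longrightarrow> e \<inter> e' \<subseteq> verts G) \<and>
     (\<forall>\<sigma>\<in>faces G. \<sigma> homeomorphic cball (0::real^2) 1) \<and>
     (\<forall>v\<in>verts G. \<exists>e\<in>edges G. \<exists>\<gamma>\<in>edge_params (verts G) e. v = pathstart \<gamma> \<or> v = pathfinish \<gamma>) \<and>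
     surface_boundary (surf G) \<subseteq> \<Union>(edges G) \<and>
     (\<forall>e\<in>edges G. \<not> e \<subseteq> surface_boundary (surf G) \<longrightarrow>
       (\<exists>\<sigma>\<in>faces G. \<exists>\<tau>\<in>faces G. \<sigma> \<noteq> \<tau> \<and> e \<in> face_edges G \<sigma> \<and> e \<in> face_edges G \<tau>))"

definition face_orientation ::
  "'a::euclidean_space surface_graph \<Rightarrow> 'a set \<Rightarrow> ('a set \<Rightarrow> 'a edge_orientation) \<Rightarrow> bool" where
  "face_orientation G \<sigma> \<theta> \<longleftrightarrow>
     (\<forall>e\<in>face_edges G \<sigma>. \<theta> e \<in> edge_orientations (verts G) e) \<and>
     (\<forall>e\<in>face_edges G \<sigma>. disc_boundary \<sigma> = e \<or>
       (\<exists>e'\<in>face_edges G \<sigma>. e' \<noteq> e \<and> sink (\<theta> e) = source (\<theta> e')))"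

definition surface_orientation ::
  "'a::euclidean_space surface_graph \<Rightarrow> ('a set \<Rightarrow> 'a set \<Rightarrow> 'a edge_orientation) \<Rightarrow> bool" where
  "surface_orientation G \<omega> \<longleftrightarrow>
     (\<forall>\<sigma>\<in>faces G. face_orientation G \<sigma> (\<omega> \<sigma>)) \<and>
     (\<forall>\<sigma>\<in>faces G. \<forall>\<tau>\<in>faces G. \<sigma> \<noteq> \<tau> \<longrightarrow>
       (\<forall>e\<in>face_edges G \<sigma> \<inter> face_edges G \<tau>. \<omega> \<sigma> e = opposite (\<omega> \<tau> e)))"

definition boundary_orientation ::
  "'a::euclidean_space surface_graph \<Rightarrow> ('a set \<Rightarrow> 'a set \<Rightarrow> 'a edge_orientation) \<Rightarrow>
     'a set \<Rightarrow> 'a edge_orientation" where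
  "boundary_orientation G \<omega> e = \<omega> (THE \<sigma>. \<sigma> \<in> faces G \<and> e \<in> face_edges G \<sigma>) e"


section \<open>Combinatorial vector fields\<close>

record 'a cvf =
  cvf_orient :: "'a set \<Rightarrow> 'a edge_orientation"
  cvf_val :: "'a set \<Rightarrow> real"

definition is_cvf :: "'a::euclidean_space surface_graph \<Rightarrow> 'a cvf \<Rightarrow> bool" where
  "is_cvf G F \<longleftrightarrow> (\<forall>e\<in>edges G. cvf_orient F e \<in> edge_orientations (verts G) e)"

type_synonym 'a oriented_edge = "'a set \<times> 'a edge_orientation"

definition orient_edges ::
  "('a set \<Rightarrow> 'a edge_orientation) \<Rightarrow> 'a set set \<Rightarrow> 'a oriented_edge set" where
  "orient_edges \<theta> A = (\<lambda>e. (e, \<theta> e)) ` A"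

definition edge_sign :: "'a oriented_edge \<Rightarrow> 'a cvf \<Rightarrow> real" where
  "edge_sign x F = (if snd x = cvf_orient F (fst x) then 1 else - 1)"

definition cvf_integral :: "'a oriented_edge set \<Rightarrow> 'a cvf \<Rightarrow> real" where
  "cvf_integral A F = (\<Sum>x\<in>A. edge_sign x F * cvf_val F (fst x))"

definition face_integral :: "'a::euclidean_space surface_graph \<Rightarrow> ('a set \<Rightarrow> real) \<Rightarrow> real" where
  "face_integral G f = (\<Sum>\<sigma>\<in>faces G. f \<sigma>)"

definition whirl ::
  "'a::euclidean_space surface_graph \<Rightarrow> ('a set \<Rightarrow> 'a set \<Rightarrow> 'a edge_orientation) \<Rightarrow>
     'a cvf \<Rightarrow> 'a set \<Rightarrow> real" where
  "whirl G \<omega> F \<sigma> = cvf_integral (orient_edges (\<omega> \<sigma>) (face_edges G \<sigma>)) F"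

end

theory Submission
  imports Defs
begin

text \<open>Expanding each whirl and exchanging the two sums turns the integral over the surface into a sum
  over edges, where an edge contributes once for every face that has it on its rim.  An edge on the
  boundary of the surface has one such face, and contributes its term of the boundary integral.  Any
  other edge has exactly two, which induce opposite orientations, so its contributions cancel.

  The cancellation needs that an edge has exactly two orientations (\<open>edge_orientations_opposite\<close>).
  Transitions between parametrizations are continuous and injective on the open unit interval, hence
  monotone, and this works for arcs and loops alike.

  The incidence counts are topological, and all rest on invariance of domain: a planar domain embedded
  in the surface is open in it and avoids its boundary (\<open>planar_image_in_surface\<close>).  Together with
  the local connectedness of the surface it shows that the rim of a face lies in the skeleton formed by
  vertices and edges.  At an interior point of a boundary edge, the complement of the skeleton is
  locally a half-disc, so exactly one face is present there (\<open>boundary_point_neighbourhood\<close>).  At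
  an interior point of another edge, the two faces given by the definition can be glued along the
  edge to a planar domain, which is then a neighbourhood of the point and excludes further faces
  (\<open>two_faces_neighbourhood\<close>).

  The sum over faces is meaningful because there are finitely many of them (\<open>finite_faces\<close>): a rim
  is an infinite subset of the skeleton, so every face touches the interior of some edge, and then that
  edge is one of its boundary edges.\<close>

section \<open>The two orientations of an edge\<close>

lemma edge_params_interior:
  assumes "\<gamma> \<in> edge_params V e"
  shows "\<gamma> ` {0<..<1} = e - V" "inj_on \<gamma> {0<..<1}" "continuous_on {0..1} \<gamma>"
proof -
  have sp: "simple_path \<gamma>" and pi: "path_image \<gamma> = e"
    and V: "\<gamma> 0 \<in> V" "\<gamma> 1 \<in> V" "\<gamma> ` {0<..<1} \<inter> V = {}"
    using assms by (auto simp: edge_params_def C1_embedded_curve_def pathstart_def pathfinish_def)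
  have "{0..1::real} = {0, 1} \<union> {0<..<1}" by auto
  then have "e = {\<gamma> 0, \<gamma> 1} \<union> \<gamma> ` {0<..<1}"
    using pi unfolding path_image_def by (metis image_Un image_insert image_empty)
  then show "\<gamma> ` {0<..<1} = e - V" using V by auto
  show "inj_on \<gamma> {0<..<1}"
    using sp unfolding simple_path_def loop_free_def inj_on_def
    by (metis atLeastAtMost_iff greaterThanLessThan_iff less_eq_real_def less_irrefl)
  show "continuous_on {0..1} \<gamma>"
    using sp by (simp add: simple_path_def path_def)
qed

lemma edge_interior:
  assumes "\<gamma> \<in> edge_params V e"
  shows "connected (e - V)" "e \<subseteq> closure (e - V)" "e - V \<noteq> {}" "compact e"
proof -
  note g = edge_params_interior[OF assms]
  have "continuous_on {0<..<1} \<gamma>" using g(3) by (rule continuous_on_subset) auto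
  then have "connected (\<gamma> ` {0<..<1})" by (rule connected_continuous_image) auto
  then show "connected (e - V)" by (simp add: g(1))
  have pi: "e = \<gamma> ` {0..1}" using assms by (auto simp: edge_params_def path_image_def)
  show "e - V \<noteq> {}" using g(1) by (metis image_is_empty greaterThanLessThan_empty_iff not_one_le_zero)
  show "compact e" unfolding pi using g(3) by (simp add: compact_continuous_image)
  have "\<gamma> ` closure {0<..<1} \<subseteq> closure (\<gamma> ` {0<..<1})"
    by (rule image_closure_subset) (use g(3) in \<open>auto intro: closure_subset[THEN subsetD]\<close>)
  then show "e \<subseteq> closure (e - V)" using g(1) pi by simp
qed

text \<open>A parametrization restricts to a homeomorphism from the open interval onto the open edge:
  closed subsets of the interval are traces of compact ones, and the open edge misses the image of
  the endpoints.  This covers loops, for which the parametrization itself is not injective.\<close>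

lemma edge_params_inverse_continuous:
  assumes "\<gamma> \<in> edge_params V e"
  shows "continuous_on (e - V) (inv_into {0<..<1} \<gamma>)"
proof (rule continuous_on_inverse_closed_map[where S = "{0<..<1}" and f = \<gamma>])
  note g = edge_params_interior[OF assms]
  show "continuous_on {0<..<1} \<gamma>" using g(3) by (rule continuous_on_subset) auto
  show "\<gamma> ` {0<..<1} = e - V" by (rule g(1))
  show "inv_into {0<..<1} \<gamma> (\<gamma> x) = x" if "x \<in> {0<..<1}" for x
    using g(2) that by (rule inv_into_f_f)
  fix U assume "closedin (top_of_set {0<..<1::real}) U"
  then obtain T where T: "closed T" "U = {0<..<1} \<inter> T" by (auto simp: closedin_closed)
  have "compact (\<gamma> ` ({0..1} \<inter> T))"
    using g(3) T(1) by (intro compact_continuous_image compact_Int_closed)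
      (auto intro: continuous_on_subset)
  moreover have "\<gamma> ` U = (e - V) \<inter> \<gamma> ` ({0..1} \<inter> T)"
  proof -
    have ends: "\<gamma> 0 \<in> V" "\<gamma> 1 \<in> V"
      using assms by (auto simp: edge_params_def pathstart_def pathfinish_def)
    have "x \<in> {0<..<1}" if "x \<in> {0..1}" "\<gamma> x \<notin> V" for x
      using that ends by (cases "x = 0"; cases "x = 1") auto
    then show ?thesis using g(1) T(2) by fastforce
  qed
  ultimately show "closedin (top_of_set (e - V)) (\<gamma> ` U)"
    by (metis closedin_closed compact_imp_closed)
qed

lemma same_direction_refl: "same_direction \<gamma> \<gamma>"
  unfolding same_direction_def by (rule exI[of _ id]) (auto simp: strict_mono_on_def)

lemma same_direction_trans:
  assumes "same_direction \<alpha> \<beta>" "same_direction \<beta> \<gamma>"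
  shows "same_direction \<alpha> \<gamma>"
proof -
  obtain h k where h: "strict_mono_on {0..1} h" "h ` {0..1} = {0..1::real}"
      "\<forall>t\<in>{0..1}. \<beta> t = \<alpha> (h t)"
    and k: "strict_mono_on {0..1} k" "k ` {0..1} = {0..1::real}" "\<forall>t\<in>{0..1}. \<gamma> t = \<beta> (k t)"
    using assms unfolding same_direction_def by blast
  have "strict_mono_on {0..1} (h \<circ> k)"
  proof (rule strict_mono_onI)
    fix r s :: real assume "r \<in> {0..1}" "s \<in> {0..1}" "r < s"
    moreover from this have "k r \<in> {0..1}" "k s \<in> {0..1}" using k(2) by blast+
    ultimately show "(h \<circ> k) r < (h \<circ> k) s"
      using strict_mono_onD[OF h(1)] strict_mono_onD[OF k(1)] by simp
  qed
  moreover have "(h \<circ> k) ` {0..1} = {0..1}" using h(2) k(2) by (metis image_comp)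
  moreover have "\<forall>t\<in>{0..1}. \<gamma> t = \<alpha> ((h \<circ> k) t)" using h k by auto
  ultimately show ?thesis unfolding same_direction_def by blast
qed

lemma same_direction_sym:
  assumes "same_direction \<alpha> \<beta>"
  shows "same_direction \<beta> \<alpha>"
proof -
  obtain h where h: "strict_mono_on {0..1} h" "h ` {0..1} = {0..1::real}"
      "\<forall>t\<in>{0..1}. \<beta> t = \<alpha> (h t)"
    using assms unfolding same_direction_def by blast
  let ?k = "inv_into {0..1} h"
  have inj: "inj_on h {0..1}" using h(1) by (rule strict_mono_on_imp_inj_on)
  have k: "?k t \<in> {0..1}" "h (?k t) = t" if "t \<in> {0..1}" for t
    using that h(2) by (auto intro: inv_into_into f_inv_into_f simp del: atLeastAtMost_iff)
  have "strict_mono_on {0..1} ?k"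
  proof (rule strict_mono_onI)
    fix r s :: real assume rs: "r \<in> {0..1}" "s \<in> {0..1}" "r < s"
    show "?k r < ?k s"
      using strict_mono_on_leD[OF h(1), of "?k s" "?k r"] k[OF rs(1)] k[OF rs(2)] rs(3)
      by (metis not_le)
  qed
  moreover have "?k ` {0..1} = {0..1}" using inj h(2) by (metis inv_into_image_cancel order_refl)
  moreover have "\<forall>t\<in>{0..1}. \<alpha> t = \<beta> (?k t)" using h(3) k by auto
  ultimately show ?thesis unfolding same_direction_def by blast
qed

lemma same_direction_reversepath:
  assumes "same_direction \<alpha> \<beta>"
  shows "same_direction (reversepath \<alpha>) (reversepath \<beta>)"
proof -
  obtain h where h: "strict_mono_on {0..1} h" "h ` {0..1} = {0..1::real}"
      "\<forall>t\<in>{0..1}. \<beta> t = \<alpha> (h t)"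
    using assms unfolding same_direction_def by blast
  let ?k = "\<lambda>t::real. 1 - h (1 - t)"
  have refl: "(\<lambda>t::real. 1 - t) ` {0..1} = {0..1}" by simp
  have "strict_mono_on {0..1} ?k" using h(1) by (auto simp: strict_mono_on_def)
  moreover have "?k ` {0..1} = {0..1}"
  proof -
    have "?k ` {0..1} = (\<lambda>t. 1 - t) ` h ` (\<lambda>t. 1 - t) ` {0..1}" by (simp only: image_image)
    then show ?thesis by (simp only: refl h(2))
  qed
  moreover have "\<forall>t\<in>{0..1}. reversepath \<beta> t = reversepath \<alpha> (?k t)"
    using h(3) by (auto simp: reversepath_def)
  ultimately show ?thesis unfolding same_direction_def by blast
qed

lemma reflect_unit_interval: "(\<lambda>t::real. 1 - t) ` {0<..<1} = {0<..<1}"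
proof
  show "{0<..<1} \<subseteq> (\<lambda>t::real. 1 - t) ` {0<..<1}"
  proof
    fix t :: real assume "t \<in> {0<..<1}"
    then have "t = 1 - (1 - t)" "1 - t \<in> {0<..<1}" by auto
    then show "t \<in> (\<lambda>t. 1 - t) ` {0<..<1}" by (rule image_eqI)
  qed
qed auto

lemma reversepath_in_edge_params:
  assumes "\<gamma> \<in> edge_params V e"
  shows "reversepath \<gamma> \<in> edge_params V e"
proof -
  obtain D where D: "continuous_on {0..1} D"
      "\<And>t. t \<in> {0..1} \<Longrightarrow> (\<gamma> has_vector_derivative D t) (at t within {0..1}) \<and> D t \<noteq> 0"
    using assms unfolding edge_params_def C1_embedded_curve_def by auto
  let ?r = "\<lambda>t::real. 1 - t"
  have r: "?r ` {0..1} = {0..1}" by simp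
  have "continuous_on {0..1} (\<lambda>t. - D (1 - t))"
    by (intro continuous_on_minus continuous_on_compose2[OF D(1)] continuous_intros) auto
  moreover have "(reversepath \<gamma> has_vector_derivative - D (1 - t)) (at t within {0..1})"
    if "t \<in> {0..1}" for t
  proof -
    have "(?r has_vector_derivative -1) (at t within {0..1})"
      by (auto intro!: derivative_eq_intros)
    moreover have "(\<gamma> has_vector_derivative D (1 - t)) (at (1 - t) within ?r ` {0..1})"
      using D(2)[of "1 - t"] that unfolding r by auto
    ultimately show ?thesis
      using vector_diff_chain_within[of ?r "-1" t "{0..1}" \<gamma> "D (1 - t)"]
      by (simp add: o_def reversepath_def)
  qed
  moreover have "D (1 - t) \<noteq> 0" if "t \<in> {0..1}" for t
    using D(2)[of "1 - t"] that by auto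
  ultimately have "\<exists>D. continuous_on {0..1} D \<and>
      (\<forall>t\<in>{0..1}. (reversepath \<gamma> has_vector_derivative D t) (at t within {0..1}) \<and> D t \<noteq> 0)"
    by (intro exI[of _ "\<lambda>t. - D (1 - t)"]) auto
  moreover have "reversepath \<gamma> ` {0<..<1} = \<gamma> ` {0<..<1}"
    unfolding reversepath_def by (metis (no_types) image_image reflect_unit_interval)
  ultimately show ?thesis
    using assms by (auto simp: edge_params_def C1_embedded_curve_def simple_path_reversepath)
qed

text \<open>The definition of direction compares parametrizations on the closed interval, while transitions
  are only determined on the open one.  The increasing extension to the closed interval is continuous, so the identity
  between the two parametrizations persists at the endpoints.\<close>

lemma same_direction_if_increasing:
  fixes g :: "real \<Rightarrow> real"
  assumes \<gamma>: "continuous_on {0..1} \<gamma>" and \<delta>: "continuous_on {0..1} (\<delta> :: real \<Rightarrow> 'a::real_normed_vector)"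
    and mono: "strict_mono_on {0<..<1} g" and im: "g ` {0<..<1} = {0<..<1}"
    and eq: "\<And>t. t \<in> {0<..<1} \<Longrightarrow> \<delta> t = \<gamma> (g t)"
  shows "same_direction \<gamma> \<delta>"
proof -
  \<comment> \<open>Extending by the identity to the whole line makes the image open, as the continuity criterion
    for monotone maps requires.\<close>
  define h where "h t = (if t \<in> {0<..<1} then g t else t)" for t
  have g01: "0 < g t \<and> g t < 1" if "t \<in> {0<..<1}" for t
    using im that by (metis greaterThanLessThan_iff imageI)
  have h: "strict_mono h"
  proof (rule strict_monoI)
    fix x y :: real assume "x < y"
    then show "h x < h y"
      using g01[of x] g01[of y] strict_mono_onD[OF mono, of x y]
      by (cases "x \<in> {0<..<1}"; cases "y \<in> {0<..<1}") (auto simp: h_def)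
  qed
  have im01: "h ` {0..1} = {0..1}"
  proof -
    have "{0..1::real} = {0, 1} \<union> {0<..<1}" by auto
    then have "h ` {0..1} = {h 0, h 1} \<union> h ` {0<..<1}" by (metis image_Un image_insert image_empty)
    also have "h ` {0<..<1} = {0<..<1}" using im by (simp add: h_def)
    also have "{h 0, h 1} = {0, 1}" by (simp add: h_def)
    finally show ?thesis using \<open>{0..1::real} = {0, 1} \<union> {0<..<1}\<close> by simp
  qed
  have surj: "range h = UNIV"
  proof -
    have "y \<in> range h" for y
    proof (cases "y \<in> {0..1}")
      case True
      then have "y \<in> h ` {0..1}" by (simp only: im01)
      then show ?thesis by blast
    next
      case False
      then have "h y = y" by (auto simp: h_def)
      then show ?thesis by (metis rangeI)
    qed
    then show ?thesis by auto
  qed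
  have cont: "continuous_on {0..1} h"
  proof (rule continuous_on_subset)
    show "continuous_on UNIV h"
      by (rule continuous_onI_mono) (use h surj in \<open>auto simp: strict_mono_less_eq\<close>)
  qed simp
  have "continuous_on {0..1} (\<lambda>t. \<delta> t - \<gamma> (h t))"
    using im01 by (intro continuous_on_diff \<delta> continuous_on_compose2[OF \<gamma> cont]) auto
  then have "continuous_on (closure {0<..<1}) (\<lambda>t. \<delta> t - \<gamma> (h t))" by simp
  then have "\<delta> t - \<gamma> (h t) = 0" if "t \<in> {0..1}" for t
    by (rule continuous_constant_on_closure) (use eq that in \<open>auto simp: h_def\<close>)
  then have "\<forall>t\<in>{0..1}. \<delta> t = \<gamma> (h t)" by simp
  moreover have "strict_mono_on {0..1} h" using h by (auto simp: strict_mono_on_def strict_mono_def)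
  ultimately show ?thesis using im01 unfolding same_direction_def by blast
qed

text \<open>On the open interval the transition from one parametrization to another is a continuous
  injection of an interval into the line, so it either increases or decreases.  The decreasing case
  becomes the increasing one after reversing.\<close>

lemma same_direction_or_reverse:
  assumes \<gamma>: "\<gamma> \<in> edge_params V e" and \<delta>: "\<delta> \<in> edge_params V e"
  shows "same_direction \<gamma> \<delta> \<or> same_direction \<gamma> (reversepath \<delta>)"
proof -
  note g = edge_params_interior[OF \<gamma>] and d = edge_params_interior[OF \<delta>]
  define k where "k = inv_into {0<..<1} \<gamma> \<circ> \<delta>"
  have eq: "\<delta> t = \<gamma> (k t)" if "t \<in> {0<..<1}" for t
    using that g(1) d(1) unfolding k_def by (metis comp_apply f_inv_into_f image_eqI)
  have bij: "bij_betw k {0<..<1} {0<..<1}"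
    unfolding k_def
    by (rule bij_betw_trans[of \<delta> _ "e - V"])
      (use g d in \<open>auto simp: bij_betw_def inj_on_inv_into inv_into_image_cancel
        intro: inv_into_into simp flip: g(1)\<close>)
  have "continuous_on {0<..<1} k"
    unfolding k_def
  proof (rule continuous_on_compose)
    show "continuous_on {0<..<1} \<delta>" using d(3) by (rule continuous_on_subset) auto
    show "continuous_on (\<delta> ` {0<..<1}) (inv_into {0<..<1} \<gamma>)"
      using edge_params_inverse_continuous[OF \<gamma>] by (simp add: d(1))
  qed
  then consider "strict_mono_on {0<..<1} k" | "strict_antimono_on {0<..<1} k"
    using injective_eq_monotone_map[of "{0<..<1}" k] bij by (auto simp: bij_betw_def is_interval_oo)
  then show ?thesis
  proof cases
    case 1
    then show ?thesis
      using same_direction_if_increasing[OF g(3) d(3) 1 _ eq] bij by (auto simp: bij_betw_def)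
  next
    case 2
    have r: "(\<lambda>t::real. 1 - t) ` {0<..<1} = {0<..<1}"
      by (fact reflect_unit_interval)
    have "strict_mono_on {0<..<1} (\<lambda>t. k (1 - t))"
      using 2 by (auto simp: strict_mono_on_def monotone_on_def)
    moreover have "(\<lambda>t. k (1 - t)) ` {0<..<1} = {0<..<1}"
    proof -
      have "(\<lambda>t. k (1 - t)) ` {0<..<1} = k ` (\<lambda>t. 1 - t) ` {0<..<1}" by (simp only: image_image)
      then show ?thesis using bij by (simp only: r bij_betw_def)
    qed
    moreover have "reversepath \<delta> t = \<gamma> (k (1 - t))" if "t \<in> {0<..<1}" for t
      using eq[of "1 - t"] that by (auto simp: reversepath_def)
    ultimately show ?thesis
      using same_direction_if_increasing[OF g(3)
          edge_params_interior(3)[OF reversepath_in_edge_params[OF \<delta>]]] by blast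
  qed
qed

text \<open>On the open interval an increasing transition from \<open>\<gamma>\<close> to its reverse would have to be the
  decreasing map \<open>t \<mapsto> 1 - t\<close>, because \<open>\<gamma>\<close> is injective there.\<close>

lemma not_same_direction_reversepath:
  assumes \<gamma>: "\<gamma> \<in> edge_params V e"
  shows "\<not> same_direction \<gamma> (reversepath \<gamma>)"
proof
  assume "same_direction \<gamma> (reversepath \<gamma>)"
  then obtain h where h: "strict_mono_on {0..1} h" "h ` {0..1} = {0..1::real}"
      "\<forall>t\<in>{0..1}. \<gamma> (1 - t) = \<gamma> (h t)"
    unfolding same_direction_def reversepath_def by blast
  have "h t = 1 - t" if "t \<in> {0<..<1}" for t
  proof -
    have "h 0 < h t" "h t < h 1" "h 0 \<in> {0..1}" "h 1 \<in> {0..1}"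
      using that strict_mono_onD[OF h(1)] h(2) by auto
    then have "h t \<in> {0<..<1}" by auto
    moreover have "\<gamma> (h t) = \<gamma> (1 - t)" using h(3) that by auto
    ultimately show ?thesis
      using edge_params_interior(2)[OF \<gamma>] that by (auto dest!: inj_onD)
  qed
  from this[of "1/3"] this[of "2/3"] have "h (1/3) = 2/3" "h (2/3) = 1/3" by auto
  with strict_mono_onD[OF h(1), of "1/3" "2/3"] show False by auto
qed

lemma edge_orientations_opposite:
  assumes d: "d \<in> edge_orientations V e"
  shows "opposite d \<in> edge_orientations V e" "opposite d \<noteq> d"
    and edge_orientations_cases: "\<And>c. c \<in> edge_orientations V e \<Longrightarrow> c = d \<or> c = opposite d"
proof -
  define cls where "cls \<gamma> = {\<delta> \<in> edge_params V e. same_direction \<gamma> \<delta>}" for \<gamma>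
  have orient: "c \<in> edge_orientations V e \<longleftrightarrow> (\<exists>\<gamma>\<in>edge_params V e. c = cls \<gamma>)" for c
    unfolding edge_orientations_def quotient_def cls_def by auto
  have cls_eq: "cls \<gamma> = cls \<delta> \<longleftrightarrow> same_direction \<gamma> \<delta>"
    if "\<gamma> \<in> edge_params V e" "\<delta> \<in> edge_params V e" for \<gamma> \<delta>
    unfolding cls_def using that same_direction_refl same_direction_trans same_direction_sym by blast
  have opp: "opposite (cls \<gamma>) = cls (reversepath \<gamma>)" if "\<gamma> \<in> edge_params V e" for \<gamma>
  proof -
    have "\<delta> \<in> reversepath ` cls \<gamma>" if "\<delta> \<in> cls (reversepath \<gamma>)" for \<delta>
    proof -
      have "reversepath \<delta> \<in> cls \<gamma>"
        using that same_direction_reversepath[of "reversepath \<gamma>" \<delta>] reversepath_in_edge_params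
        unfolding cls_def by auto
      then show ?thesis by (metis image_eqI reversepath_reversepath)
    qed
    then show ?thesis
      unfolding opposite_def cls_def
      by (auto simp: same_direction_reversepath reversepath_in_edge_params)
  qed
  obtain \<gamma> where \<gamma>: "\<gamma> \<in> edge_params V e" "d = cls \<gamma>" using d orient by auto
  show "opposite d \<in> edge_orientations V e"
    unfolding orient \<gamma>(2) opp[OF \<gamma>(1)] using reversepath_in_edge_params[OF \<gamma>(1)] by blast
  show "opposite d \<noteq> d"
    using cls_eq[OF \<gamma>(1) reversepath_in_edge_params[OF \<gamma>(1)]]
      not_same_direction_reversepath[OF \<gamma>(1)] opp[OF \<gamma>(1)] \<gamma>(2) by auto
  fix c assume "c \<in> edge_orientations V e"
  then obtain \<delta> where \<delta>: "\<delta> \<in> edge_params V e" "c = cls \<delta>" using orient by auto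
  show "c = d \<or> c = opposite d"
  proof (cases "same_direction \<gamma> \<delta>")
    case True
    then show ?thesis using cls_eq[OF \<gamma>(1) \<delta>(1)] \<gamma>(2) \<delta>(2) by auto
  next
    case False
    then have "same_direction (reversepath \<gamma>) \<delta>"
      using same_direction_or_reverse[OF \<gamma>(1) \<delta>(1)]
        same_direction_reversepath[of \<gamma> "reversepath \<delta>"] by auto
    then show ?thesis
      using cls_eq[OF reversepath_in_edge_params[OF \<gamma>(1)] \<delta>(1)] opp[OF \<gamma>(1)] \<gamma>(2) \<delta>(2) by auto
  qed
qed

text \<open>An edge has exactly the two orientations \<open>d\<close> and \<open>opposite d\<close>, so a vector field agrees with
  exactly one of them.  This is the cancellation along edges between two faces.\<close>

lemma edge_sign_opposite:
  assumes "d \<in> edge_orientations V e" "cvf_orient F e \<in> edge_orientations V e"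
  shows "edge_sign (e, opposite d) F = - edge_sign (e, d) F"
  using edge_orientations_opposite[OF assms(1)] edge_orientations_cases[OF assms]
  by (auto simp: edge_sign_def)


section \<open>Embedded planar domains in a surface\<close>

text \<open>Invariance of domain is used in two forms: a planar domain embedded in the closed disc misses the
  circle, and one embedded in the half-plane misses the boundary line.\<close>

lemma planar_image_in_disc:
  fixes f :: "real^2 \<Rightarrow> real^2"
  assumes "open A" "continuous_on A f" "inj_on f A" "f ` A \<subseteq> cball 0 1"
  shows "f ` A \<subseteq> ball 0 1"
  using invariance_of_domain[OF assms(2,1,3)] assms(4) by (metis interior_cball interior_maximal)

lemma planar_image_in_half_plane:
  fixes f :: "real^2 \<Rightarrow> real^2"
  assumes "open A" "continuous_on A f" "inj_on f A" "f ` A \<subseteq> half_plane"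
  shows "f ` A \<subseteq> {x. 0 < x $ 2}"
  using interior_maximal[OF assms(4) invariance_of_domain[OF assms(2,1,3)]]
  by (simp add: half_plane_def)

text \<open>The union over all parametrizations of the disc collapses to the rim of a single one: two
  parametrizations differ by a self-homeomorphism of the disc, which maps the open disc into itself.\<close>

lemma disc_boundary_homeomorphism:
  fixes \<sigma> :: "'a::euclidean_space set"
  assumes h: "homeomorphism (cball (0::real^2) 1) \<sigma> h g"
  shows "disc_boundary \<sigma> = h ` sphere 0 1"
proof
  show "h ` sphere 0 1 \<subseteq> disc_boundary \<sigma>" unfolding disc_boundary_def using h by blast
  show "disc_boundary \<sigma> \<subseteq> h ` sphere 0 1"
  proof
    fix p assume "p \<in> disc_boundary \<sigma>"
    then obtain k l where k: "homeomorphism (cball (0::real^2) 1) \<sigma> k l" and p: "p \<in> k ` sphere 0 1"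
      unfolding disc_boundary_def by blast
    have p\<sigma>: "p \<in> \<sigma>" using k p by (auto simp: homeomorphism_def)
    have lh: "homeomorphism (cball 0 1) (cball 0 1) (l \<circ> h) (g \<circ> k)"
      using h homeomorphism_symD[OF k] by (rule homeomorphism_compose)
    have "(l \<circ> h) ` ball 0 1 \<subseteq> ball 0 1"
    proof (rule planar_image_in_disc)
      show "continuous_on (ball 0 1) (l \<circ> h)"
        using homeomorphism_cont1[OF lh] by (rule continuous_on_subset) auto
      show "inj_on (l \<circ> h) (ball 0 1)"
        by (rule inj_on_inverseI[where g = "g \<circ> k"])
          (use homeomorphism_apply1[OF lh] in \<open>auto simp del: o_apply\<close>)
      show "(l \<circ> h) ` ball 0 1 \<subseteq> cball 0 1"
        using homeomorphism_image1[OF lh] ball_subset_cball by (metis image_mono)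
    qed simp
    moreover have "l p \<in> sphere 0 1" using k p by (auto simp: homeomorphism_def)
    moreover have gp: "g p \<in> cball 0 1" "h (g p) = p" using h p\<sigma> by (auto simp: homeomorphism_def)
    moreover have "g p \<notin> ball 0 1"
    proof
      assume "g p \<in> ball 0 1"
      then have "l (h (g p)) \<in> ball 0 1" using calculation(1) by (metis comp_apply image_subset_iff)
      then show False using calculation(2,4) by simp
    qed
    ultimately have "g p \<in> sphere 0 1" by simp
    then show "p \<in> h ` sphere 0 1" using gp(2) by (metis imageI)
  qed
qed

lemma smooth_surface_chart:
  assumes "smooth_surface S" "p \<in> S"
  obtains W \<phi> \<psi> where "openin (top_of_set S) W" "openin (top_of_set half_plane) (\<phi> ` W)"
    "homeomorphism W (\<phi> ` W) \<phi> \<psi>" "p \<in> W" "surface_chart S W \<phi>"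
proof -
  obtain W \<phi> where W: "surface_chart S W \<phi>" "p \<in> W"
    using assms unfolding smooth_surface_def by blast
  then obtain \<psi> where "homeomorphism W (\<phi> ` W) \<phi> \<psi>" unfolding surface_chart_def by blast
  then show thesis using that[of W \<phi> \<psi>] W unfolding surface_chart_def by blast
qed

text \<open>In a chart, the image of a planar domain is open in the plane by invariance of domain.  It
  therefore avoids the boundary line of the half-plane, and it is a neighbourhood in the surface.\<close>

lemma planar_image_in_surface:
  fixes k :: "real^2 \<Rightarrow> 'a::euclidean_space"
  assumes S: "smooth_surface S" and A: "open A" "continuous_on A k" "inj_on k A" "k ` A \<subseteq> S"
  shows "openin (top_of_set S) (k ` A)" "k ` A \<inter> surface_boundary S = {}"
proof -
  have chart: "open ((\<phi> \<circ> k) ` (A \<inter> k -` W))" "(\<phi> \<circ> k) ` (A \<inter> k -` W) \<subseteq> {x. 0 < x $ 2}"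
    if W: "openin (top_of_set S) W" "openin (top_of_set half_plane) (\<phi> ` W)"
      and h: "homeomorphism W (\<phi> ` W) \<phi> \<psi>" for W \<psi> and \<phi> :: "'a \<Rightarrow> real^2"
  proof -
    let ?B = "A \<inter> k -` W"
    have "openin (top_of_set A) ?B"
      using A(2,4) W(1) by (intro continuous_openin_preimage[of _ _ S]) auto
    then have B: "open ?B" using A(1) openin_open_eq by blast
    have cont: "continuous_on ?B (\<phi> \<circ> k)"
    proof (rule continuous_on_compose)
      show "continuous_on ?B k" using A(2) by (rule continuous_on_subset) auto
      show "continuous_on (k ` ?B) \<phi>"
        using homeomorphism_cont1[OF h] by (rule continuous_on_subset) auto
    qed
    have inj: "inj_on (\<phi> \<circ> k) ?B"
    proof (rule comp_inj_on)
      show "inj_on k ?B" using A(3) by (rule inj_on_subset) auto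
      show "inj_on \<phi> (k ` ?B)"
        by (rule inj_on_inverseI[where g = \<psi>]) (use homeomorphism_apply1[OF h] in auto)
    qed
    show "open ((\<phi> \<circ> k) ` ?B)" using cont B inj by (rule invariance_of_domain)
    have "(\<phi> \<circ> k) ` ?B \<subseteq> half_plane" using openin_imp_subset[OF W(2)] by auto
    then show "(\<phi> \<circ> k) ` ?B \<subseteq> {x. 0 < x $ 2}"
      by (rule planar_image_in_half_plane[OF B cont inj])
  qed
  show "k ` A \<inter> surface_boundary S = {}"
  proof (rule equals0I)
    fix p assume "p \<in> k ` A \<inter> surface_boundary S"
    then obtain W \<phi> where W: "surface_chart S W \<phi>" "p \<in> W" "\<phi> p $ 2 = 0" and p: "p \<in> k ` A"
      unfolding surface_boundary_def by auto
    then show False using chart(2)[of W \<phi>] unfolding surface_chart_def by fastforce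
  qed
  show "openin (top_of_set S) (k ` A)"
  proof (subst openin_subopen, intro ballI)
    fix p assume p: "p \<in> k ` A"
    then have "p \<in> S" using A(4) by auto
    then obtain W \<phi> \<psi> where W: "openin (top_of_set S) W" "openin (top_of_set half_plane) (\<phi> ` W)"
      and h: "homeomorphism W (\<phi> ` W) \<phi> \<psi>" and pW: "p \<in> W"
      using smooth_surface_chart[OF S] by metis
    let ?B = "A \<inter> k -` W"
    have "openin (top_of_set W) (W \<inter> \<phi> -` ((\<phi> \<circ> k) ` ?B))"
      using homeomorphism_cont1[OF h] chart(1)[OF W h]
      by (rule continuous_openin_preimage_gen)
    then have op: "openin (top_of_set S) (W \<inter> \<phi> -` ((\<phi> \<circ> k) ` ?B))"
      using W(1) openin_trans by blast
    have "W \<inter> \<phi> -` ((\<phi> \<circ> k) ` ?B) = k ` ?B"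
    proof -
      have "x = k z" if "x \<in> W" "z \<in> ?B" "\<phi> x = \<phi> (k z)" for x z
        using that homeomorphism_apply1[OF h] by (metis IntD2 vimageE)
      then show ?thesis by auto
    qed
    then show "\<exists>T. openin (top_of_set S) T \<and> p \<in> T \<and> T \<subseteq> k ` A"
      using op p pW by (intro exI[of _ "k ` ?B"]) auto
  qed
qed

text \<open>Intersections of balls with the half-plane are convex, so charts provide arbitrarily small
  connected neighbourhoods.\<close>

lemma chart_neighbourhood:
  fixes S :: "'a::euclidean_space set" and \<phi> :: "'a \<Rightarrow> real^2"
  assumes W: "openin (top_of_set S) W" "openin (top_of_set half_plane) (\<phi> ` W)"
    and h: "homeomorphism W (\<phi> ` W) \<phi> \<psi>" and p: "p \<in> W" and U: "open U" "p \<in> U"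
  obtains N r where "openin (top_of_set S) N" "p \<in> N" "N \<subseteq> W \<inter> U" "0 < r"
    "homeomorphism N (ball (\<phi> p) r \<inter> half_plane) \<phi> \<psi>" "connected N"
proof -
  have "openin (top_of_set (\<phi> ` W)) (\<phi> ` (W \<inter> U))"
    using h U(1) by (intro homeomorphism_imp_open_map[OF h]) (auto simp: openin_open_Int)
  then have "openin (top_of_set half_plane) (\<phi> ` (W \<inter> U))" using W(2) openin_trans by blast
  then obtain r where r: "r > 0" "ball (\<phi> p) r \<inter> half_plane \<subseteq> \<phi> ` (W \<inter> U)"
    using p U(2) unfolding openin_contains_ball by blast
  let ?D = "ball (\<phi> p) r \<inter> half_plane"
  let ?N = "\<psi> ` ?D"
  have D: "?D \<subseteq> \<phi> ` W" using r(2) by auto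
  have N: "?N \<subseteq> W \<inter> U"
  proof
    fix x assume "x \<in> ?N"
    then obtain y where y: "y \<in> W \<inter> U" "x = \<psi> (\<phi> y)" using r(2) by blast
    then show "x \<in> W \<inter> U" using homeomorphism_apply1[OF h] by auto
  qed
  have hN: "homeomorphism ?N ?D \<phi> \<psi>"
    using homeomorphism_symD[OF homeomorphism_of_subsets[OF homeomorphism_symD[OF h] D _ refl]] N
    by auto
  have "openin (top_of_set (\<phi> ` W)) ?D"
    using D by (metis openin_imp_subset W(2) openin_open_Int openin_subset_trans
        open_ball inf_commute)
  then have "openin (top_of_set W) ?N" by (rule homeomorphism_imp_open_map[OF homeomorphism_symD[OF h]])
  then have op: "openin (top_of_set S) ?N" using W(1) openin_trans by blast
  have "\<phi> p \<in> ?D" using r(1) p openin_imp_subset[OF W(2)] by auto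
  then have "p \<in> ?N" using homeomorphism_apply1[OF h p] by (metis imageI)
  moreover have "convex half_plane"
    unfolding half_plane_def convex_def by auto
  then have "connected ?D" by (intro convex_connected convex_Int) auto
  then have "connected ?N"
    using homeomorphism_cont2[OF hN] by (metis connected_continuous_image)
  ultimately show thesis using that[OF op _ N r(1) hN] by blast
qed

lemma openin_disjoint_closure:
  assumes "openin (top_of_set S) A" "B \<subseteq> S" "A \<inter> B = {}"
  shows "A \<inter> closure B = {}"
proof -
  obtain T where T: "open T" "A = S \<inter> T" using assms(1) by (auto simp: openin_open)
  then have "T \<inter> B = {}" using assms(2,3) by auto
  then have "T \<inter> closure B = {}" using T(1) open_Int_closure_eq_empty by blast
  then show ?thesis using T(2) by auto
qed

text \<open>Reflecting the second disc to the outside of the unit circle glues the two discs along the part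
  \<open>B\<close> of their rims that is identified: the glued map is \<open>h1\<close> inside the circle, and outside it the
  point at radius \<open>r\<close> goes to the point of the second disc at radius \<open>1 / r\<close> on the corresponding ray.
  The open second disc avoids the first one, so the result is injective on a planar neighbourhood of
  \<open>B\<close>, to which invariance of domain applies.\<close>

lemma glue_discs:
  fixes h1 h2 :: "real^2 \<Rightarrow> 'a::euclidean_space"
  assumes h1: "homeomorphism (cball 0 1) \<sigma> h1 g1" and h2: "homeomorphism (cball 0 1) \<tau> h2 g2"
    and disj: "h2 ` ball 0 1 \<inter> \<sigma> = {}"
    and B: "openin (top_of_set (sphere 0 1)) B" and h1B: "h1 ` B \<subseteq> h2 ` sphere 0 1"
  obtains A k where "open A" "B \<subseteq> A" "continuous_on A k" "inj_on k A" "k ` A \<subseteq> \<sigma> \<union> \<tau>"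
    "\<forall>z\<in>B. k z = h1 z"
proof -
  \<comment> \<open>\<open>\<rho>\<close> matches the rims, and \<open>o2\<close> is the reflected second disc.\<close>
  define \<rho> where "\<rho> = g2 \<circ> h1"
  define A where "A = {z. z \<noteq> 0 \<and> sgn z \<in> B}"
  define o2 where "o2 z = h2 (\<rho> (sgn z) /\<^sub>R norm z)" for z
  define k where "k z = (if norm z \<le> 1 then h1 z else o2 z)" for z
  obtain T where T: "open T" "B = sphere 0 1 \<inter> T" using B by (auto simp: openin_open)
  have Bn: "norm z = 1" if "z \<in> B" for z using that T(2) by auto
  have \<rho>: "norm (\<rho> z) = 1" "h2 (\<rho> z) = h1 z" if "z \<in> B" for z
  proof -
    have "h1 z \<in> h2 ` sphere 0 1" using h1B that by (simp only: image_subset_iff)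
    then obtain s where s: "s \<in> sphere 0 1" "h1 z = h2 s" by (rule imageE)
    then have "\<rho> z = s" using homeomorphism_apply1[OF h2, of s] by (simp add: \<rho>_def)
    then show "norm (\<rho> z) = 1" "h2 (\<rho> z) = h1 z" using s by auto
  qed
  have contsgn: "continuous_on X sgn" if "0 \<notin> X" for X :: "(real^2) set"
    using that by (intro continuous_on_sgn[OF continuous_on_id]) auto
  have "open (- {0} \<inter> sgn -` T)"
    by (rule continuous_open_preimage[OF contsgn]) (use T(1) in auto)
  moreover have "A = - {0} \<inter> sgn -` T" using T(2) by (auto simp: A_def norm_sgn)
  ultimately have oA: "open A" by simp
  have BA: "B \<subseteq> A" using Bn by (force simp: A_def sgn_div_norm)
  define A1 where "A1 = A \<inter> cball 0 1"
  define A2 where "A2 = A \<inter> (- ball 0 1)"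
  have AU: "A = A1 \<union> A2" by (auto simp: A1_def A2_def)
  have cl: "closedin (top_of_set A) A1" "closedin (top_of_set A) A2"
    unfolding A1_def A2_def by (intro closedin_closed_Int; simp add: closed_Compl)+
  have c1: "continuous_on A1 h1"
    using homeomorphism_cont1[OF h1] by (rule continuous_on_subset) (auto simp: A1_def)
  have sgnA: "sgn z \<in> B" "z \<noteq> 0" if "z \<in> A" for z using that by (auto simp: A_def)
  have norm_arg: "norm (\<rho> (sgn z) /\<^sub>R norm z) = 1 / norm z" if "z \<in> A" for z
    using \<rho>(1)[OF sgnA(1)[OF that]] by (simp add: divide_inverse)
  have c2: "continuous_on A2 o2"
    unfolding o2_def
  proof (rule continuous_on_compose2[OF homeomorphism_cont1[OF h2]])
    have s: "continuous_on A2 sgn" by (rule contsgn) (auto simp: A2_def)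
    have sB: "sgn z \<in> cball 0 1" if "z \<in> A2" for z
      using sgnA(1)[of z] Bn[of "sgn z"] that by (auto simp: A2_def)
    have "continuous_on A2 (\<lambda>z. h1 (sgn z))"
      by (rule continuous_on_compose2[OF homeomorphism_cont1[OF h1] s]) (use sB in blast)
    moreover have "(\<lambda>z. h1 (sgn z)) ` A2 \<subseteq> \<tau>"
    proof (clarify)
      fix z assume "z \<in> A2"
      then have "h1 (sgn z) \<in> h2 ` sphere 0 1" using h1B sgnA by (auto simp: A2_def)
      then show "h1 (sgn z) \<in> \<tau>" using homeomorphism_image1[OF h2] sphere_cball by blast
    qed
    ultimately have "continuous_on A2 (\<lambda>z. \<rho> (sgn z))"
      unfolding \<rho>_def o_def by (rule continuous_on_compose2[OF homeomorphism_cont2[OF h2]])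
    then show "continuous_on A2 (\<lambda>z. \<rho> (sgn z) /\<^sub>R norm z)"
      by (intro continuous_intros) (auto simp: A2_def)
    show "(\<lambda>z. \<rho> (sgn z) /\<^sub>R norm z) ` A2 \<subseteq> cball 0 1"
    proof clarify
      fix z assume z: "z \<in> A2"
      then have "norm z \<ge> 1" "z \<in> A" by (auto simp: A2_def)
      then have "1 / norm z \<le> 1" by (subst divide_le_eq_1) linarith
      then show "\<rho> (sgn z) /\<^sub>R norm z \<in> cball 0 1"
        using norm_arg[OF \<open>z \<in> A\<close>] by (simp only: mem_cball_0)
    qed
  qed
  have "continuous_on (A1 \<union> A2) k"
    unfolding k_def
  proof (rule continuous_on_cases_local)
    show "h1 z = o2 z" if "z \<in> A1 \<and> \<not> norm z \<le> 1 \<or> z \<in> A2 \<and> norm z \<le> 1" for z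
    proof -
      have "norm z = 1" "z \<in> A" using that by (auto simp: A1_def A2_def)
      then have "sgn z = z" by (simp add: sgn_div_norm)
      then show ?thesis using \<rho>(2)[of z] sgnA(1)[OF \<open>z \<in> A\<close>] \<open>norm z = 1\<close> by (simp add: o2_def)
    qed
  qed (use cl c1 c2 AU in auto)
  then have ck: "continuous_on A k" using AU by simp
  have k1: "k z \<in> \<sigma>" if "norm z \<le> 1" for z
    using that homeomorphism_image1[OF h1] by (auto simp: k_def)
  have arg: "\<rho> (sgn z) /\<^sub>R norm z \<in> ball 0 1" if "z \<in> A" "\<not> norm z \<le> 1" for z
  proof -
    have "1 / norm z < 1" using that(2) by (subst divide_less_eq_1) linarith
    then show ?thesis using norm_arg[OF that(1)] by (simp only: mem_ball_0)
  qed
  have k2: "k z \<in> h2 ` ball 0 1" if "z \<in> A" "\<not> norm z \<le> 1" for z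
    using arg[OF that] that(2) by (simp add: k_def o2_def)
  have "inj_on k A"
  proof (rule inj_onI)
    fix z w assume zw: "z \<in> A" "w \<in> A" "k z = k w"
    consider "norm z \<le> 1" "norm w \<le> 1" | "\<not> norm z \<le> 1" "\<not> norm w \<le> 1"
      using k1[of z] k1[of w] k2[of z] k2[of w] zw disj by (metis disjoint_iff)
    then show "z = w"
    proof cases
      case 1
      then have "h1 z = h1 w" using zw(3) by (simp add: k_def)
      then show ?thesis using 1 homeomorphism_apply1[OF h1] by (metis mem_cball_0)
    next
      case 2
      let ?a = "\<lambda>z. \<rho> (sgn z) /\<^sub>R norm z"
      have "h2 (?a z) = h2 (?a w)" using zw(3) 2 by (simp add: k_def o2_def)
      then have eq: "?a z = ?a w"
        using homeomorphism_apply1[OF h2] arg[OF zw(1) 2(1)] arg[OF zw(2) 2(2)]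
        by (metis subsetD[OF ball_subset_cball])
      then have n: "norm z = norm w"
        using norm_arg[OF zw(1)] norm_arg[OF zw(2)] by (metis inverse_eq_divide inverse_eq_iff_eq)
      then have "\<rho> (sgn z) = \<rho> (sgn w)" using eq sgnA(2)[OF zw(2)] by simp
      then have "h1 (sgn z) = h1 (sgn w)" using \<rho>(2) sgnA(1) zw by metis
      then have "sgn z = sgn w"
        using homeomorphism_apply1[OF h1] Bn[OF sgnA(1)[OF zw(1)]] Bn[OF sgnA(1)[OF zw(2)]]
        by (metis mem_cball_0 order_refl)
      then show ?thesis using n sgnA(2) zw by (simp add: sgn_div_norm)
    qed
  qed
  moreover have "k ` A \<subseteq> \<sigma> \<union> \<tau>"
    using k1 k2 homeomorphism_image1[OF h2] ball_subset_cball by blast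
  moreover have "\<forall>z\<in>B. k z = h1 z" using Bn by (simp add: k_def)
  ultimately show thesis using that[OF oA BA ck] by blast
qed


section \<open>Faces and edges of a combinatorial surface\<close>

locale comb_surface =
  fixes G :: "'a::euclidean_space surface_graph"
  assumes G: "combinatorial_surface G"
begin

abbreviation S where "S \<equiv> surf G"
abbreviation V where "V \<equiv> verts G"
abbreviation E where "E \<equiv> edges G"

definition skeleton where "skeleton = V \<union> \<Union>E"

lemma shows compact_S: "compact S" and smooth_S: "smooth_surface S" and finite_V: "finite V"
    and finite_E: "finite E" and boundary_in_edges: "surface_boundary S \<subseteq> \<Union>E"
  using G by (auto simp: combinatorial_surface_def)

lemma edge_param:
  assumes "e \<in> E"
  obtains \<gamma> where "\<gamma> \<in> edge_params V e"
proof -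
  have "edge_params V e \<noteq> {}" using assms G by (simp add: combinatorial_surface_def)
  then show thesis using that by blast
qed

lemma edges_meet: "e \<in> E \<Longrightarrow> e' \<in> E \<Longrightarrow> e \<noteq> e' \<Longrightarrow> e \<inter> e' \<subseteq> V"
  and edge_in_S: "e \<in> E \<Longrightarrow> e \<subseteq> S"
  using G by (auto simp: combinatorial_surface_def)

lemma closed_edge: "e \<in> E \<Longrightarrow> closed e"
  using edge_param edge_interior(4) compact_imp_closed by metis

lemma closed_skeleton: "closed skeleton"
  unfolding skeleton_def using finite_V finite_E closed_edge
  by (intro closed_Un closed_Union finite_imp_closed) auto

text \<open>The complement of this closed set isolates the interior points of \<open>e\<close> from the rest of the
  skeleton.\<close>

definition other_cells where "other_cells e = V \<union> \<Union>(E - {e})"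

lemma closed_other_cells: "closed (other_cells e)"
  unfolding other_cells_def using finite_V finite_E closed_edge
  by (intro closed_Un closed_Union finite_imp_closed) auto

lemma skeleton_split: "e \<in> E \<Longrightarrow> skeleton = e \<union> other_cells e"
  unfolding other_cells_def skeleton_def by auto

lemma open_edge_eq: "e \<in> E \<Longrightarrow> e - V = e - other_cells e"
  unfolding other_cells_def using edges_meet by blast

lemma face_component:
  assumes "\<sigma> \<in> faces G"
  obtains C where "C \<in> components (S - skeleton)" "\<sigma> = closure C"
  using assms unfolding faces_def skeleton_def by auto

lemma component_face: "C \<in> components (S - skeleton) \<Longrightarrow> closure C \<in> faces G"
  unfolding faces_def skeleton_def by auto

lemma face_in_S: "\<sigma> \<in> faces G \<Longrightarrow> \<sigma> \<subseteq> S"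
  by (metis face_component closure_minimal compact_S compact_imp_closed in_components_subset
      Diff_subset order_trans)

lemma face_disc:
  assumes "\<sigma> \<in> faces G"
  obtains h g where "homeomorphism (cball (0::real^2) 1) \<sigma> h g"
  using assms G homeomorphic_sym unfolding combinatorial_surface_def homeomorphic_def by metis

lemma component_open:
  assumes "C \<in> components (S - skeleton)"
  shows "openin (top_of_set S) C"
proof (subst openin_subopen, intro ballI)
  fix p assume p: "p \<in> C"
  then have pS: "p \<in> S" "p \<in> - skeleton" using in_components_subset[OF assms] by auto
  obtain W \<phi> \<psi> where "openin (top_of_set S) W" "openin (top_of_set half_plane) (\<phi> ` W)"
    "homeomorphism W (\<phi> ` W) \<phi> \<psi>" "p \<in> W"
    using smooth_surface_chart[OF smooth_S pS(1)] .
  then obtain N where N: "openin (top_of_set S) N" "p \<in> N" "N \<subseteq> W \<inter> - skeleton" "connected N"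
    using chart_neighbourhood[of S W \<phi> \<psi> p "- skeleton"] closed_skeleton pS(2)
    by (metis open_Compl)
  have "N \<subseteq> C"
    using assms N p openin_imp_subset[OF N(1)] by (intro components_maximal[of C "S - skeleton"]) auto
  then show "\<exists>T. openin (top_of_set S) T \<and> p \<in> T \<and> T \<subseteq> C" using N by blast
qed

text \<open>Components are open in the surface, hence a component that meets the closure of another meets the
  other itself.\<close>

lemma component_meets_face:
  assumes "C \<in> components (S - skeleton)" "C' \<in> components (S - skeleton)" "C \<inter> closure C' \<noteq> {}"
  shows "C = C'"
proof (rule ccontr)
  assume "C \<noteq> C'"
  then have "C \<inter> C' = {}" using components_nonoverlap[OF assms(1,2)] by auto
  moreover have "C' \<subseteq> S" using in_components_subset[OF assms(2)] by auto
  ultimately show False using openin_disjoint_closure[OF component_open[OF assms(1)]] assms(3) by blast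
qed

text \<open>A face adjacent to a point meets every neighbourhood of it, so a neighbourhood covered by
  some faces determines all faces at the point.\<close>

lemma face_in_cover:
  assumes "openin (top_of_set S) N" "p \<in> N" "\<sigma> \<in> faces G" "p \<in> \<sigma>" "\<F> \<subseteq> faces G" "N \<subseteq> \<Union>\<F>"
  shows "\<sigma> \<in> \<F>"
proof -
  obtain C where C: "C \<in> components (S - skeleton)" "\<sigma> = closure C" using face_component assms(3) .
  have "C \<subseteq> S" using in_components_subset[OF C(1)] by auto
  then obtain x where x: "x \<in> N" "x \<in> C"
    using openin_disjoint_closure[OF assms(1), of C] assms(2,4) C(2) by blast
  then obtain \<tau> where \<tau>: "\<tau> \<in> \<F>" "x \<in> \<tau>" using assms(6) by auto
  then obtain C' where C': "C' \<in> components (S - skeleton)" "\<tau> = closure C'"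
    using face_component assms(5) by blast
  have "C = C'" using component_meets_face[OF C(1) C'(1)] x(2) \<tau>(2) C'(2) by auto
  then show ?thesis using \<tau>(1) C(2) C'(2) by simp
qed

lemma face_interior:
  assumes "\<sigma> \<in> faces G" and h: "homeomorphism (cball (0::real^2) 1) \<sigma> h g"
  shows "openin (top_of_set S) (h ` ball 0 1)" "h ` ball 0 1 \<inter> surface_boundary S = {}"
proof -
  have "continuous_on (ball 0 1) h"
    using homeomorphism_cont1[OF h] by (rule continuous_on_subset) auto
  moreover have "inj_on h (ball 0 1)"
    by (rule inj_on_inverseI[where g = g]) (use homeomorphism_apply1[OF h] in auto)
  moreover have "h ` ball 0 1 \<subseteq> S"
    using face_in_S[OF assms(1)] homeomorphism_image1[OF h] ball_subset_cball by blast
  ultimately show "openin (top_of_set S) (h ` ball 0 1)" "h ` ball 0 1 \<inter> surface_boundary S = {}"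
    using planar_image_in_surface[OF smooth_S open_ball] by blast+
qed

lemma face_interior_disjoint:
  assumes "\<sigma> \<in> faces G" "\<tau> \<in> faces G" "\<sigma> \<noteq> \<tau>" and h: "homeomorphism (cball (0::real^2) 1) \<sigma> h g"
  shows "h ` ball 0 1 \<inter> \<tau> = {}"
proof (rule equals0I)
  fix p assume p: "p \<in> h ` ball 0 1 \<inter> \<tau>"
  have "h ` ball 0 1 \<subseteq> \<sigma>"
    using homeomorphism_image1[OF h] ball_subset_cball by blast
  then have "\<tau> \<in> {\<sigma>}"
    using face_in_cover[OF face_interior(1)[OF assms(1) h], of p \<tau> "{\<sigma>}"] p assms(1,2) by auto
  then show False using assms(3) by simp
qed

text \<open>A point of a face off the skeleton is interior to the surface and, together with a
  neighbourhood, lies in the open component.  A planar neighbourhood of it inside the disc cannot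
  reach the bounding circle.\<close>

lemma face_rim_in_skeleton:
  assumes \<sigma>: "\<sigma> \<in> faces G" and h: "homeomorphism (cball (0::real^2) 1) \<sigma> h g"
  shows "h ` sphere 0 1 \<subseteq> skeleton"
proof (rule ccontr)
  assume "\<not> h ` sphere 0 1 \<subseteq> skeleton"
  then obtain z where z: "z \<in> sphere 0 1" "h z \<notin> skeleton" by blast
  let ?q = "h z"
  have q\<sigma>: "?q \<in> \<sigma>" using z(1) homeomorphism_image1[OF h] by (auto simp: image_iff)
  then have qS: "?q \<in> S" using face_in_S[OF \<sigma>] by auto
  obtain C where C: "C \<in> components (S - skeleton)" "\<sigma> = closure C" using face_component \<sigma> .
  obtain C' where C': "C' \<in> components (S - skeleton)" "?q \<in> C'"
    using qS z(2) UnionI Union_components[of "S - skeleton"] by (metis Diff_iff UnionE)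
  then have qC: "?q \<in> C" using component_meets_face[OF C'(1) C(1)] q\<sigma> C(2) by blast
  obtain W \<phi> \<psi> where W: "openin (top_of_set S) W" "openin (top_of_set half_plane) (\<phi> ` W)"
    "homeomorphism W (\<phi> ` W) \<phi> \<psi>" "?q \<in> W" "surface_chart S W \<phi>"
    using smooth_surface_chart[OF smooth_S qS] .
  obtain T where T: "open T" "C = S \<inter> T" using component_open[OF C(1)] by (auto simp: openin_open)
  have qT: "?q \<in> T" using T qC by auto
  obtain N r where N: "openin (top_of_set S) N" "N \<subseteq> W \<inter> T" "0 < r"
      "homeomorphism N (ball (\<phi> ?q) r \<inter> half_plane) \<phi> \<psi>"
    using chart_neighbourhood[OF W(1-4) T(1) qT] by metis
  have "N \<subseteq> C" using N(1,2) T(2) openin_imp_subset by fastforce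
  then have N\<sigma>: "N \<subseteq> \<sigma>" using C(2) closure_subset by blast
  have "?q \<notin> surface_boundary S" using z(2) boundary_in_edges by (auto simp: skeleton_def)
  then have "\<phi> ?q $ 2 \<noteq> 0" using W(4,5) unfolding surface_boundary_def by auto
  moreover have "\<phi> ?q \<in> half_plane" using W(2,4) openin_imp_subset by blast
  ultimately have pos: "\<phi> ?q \<in> {x. 0 < x $ 2}" by (simp add: half_plane_def)
  define A where "A = ball (\<phi> ?q) r \<inter> {x::real^2. 0 < x $ 2}"
  have A: "open A" "A \<subseteq> ball (\<phi> ?q) r \<inter> half_plane"
    unfolding A_def half_plane_def by (auto intro!: open_Int open_halfspace_component_gt_cart)
  have \<psi>A: "\<psi> ` A \<subseteq> N" using A(2) homeomorphism_image2[OF N(4)] by blast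
  have "(g \<circ> \<psi>) ` A \<subseteq> ball 0 1"
  proof (rule planar_image_in_disc)
    show "continuous_on A (g \<circ> \<psi>)"
      using homeomorphism_cont2[OF N(4)] homeomorphism_cont2[OF h] A(2) \<psi>A N\<sigma>
      by (meson continuous_on_compose continuous_on_subset order_trans)
    show "inj_on (g \<circ> \<psi>) A"
    proof (rule inj_on_inverseI[where g = "\<phi> \<circ> h"])
      fix x assume x: "x \<in> A"
      then have "\<psi> x \<in> \<sigma>" using \<psi>A N\<sigma> by auto
      moreover have "\<phi> (\<psi> x) = x" using homeomorphism_apply2[OF N(4)] A(2) x by blast
      ultimately show "(\<phi> \<circ> h) ((g \<circ> \<psi>) x) = x" using homeomorphism_apply2[OF h] by simp
    qed
    show "(g \<circ> \<psi>) ` A \<subseteq> cball 0 1"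
      using \<psi>A N\<sigma> homeomorphism_image2[OF h] by (auto simp: image_comp [symmetric])
  qed (rule A(1))
  moreover have "\<phi> ?q \<in> A" using pos N(3) by (simp add: A_def)
  ultimately have "g (\<psi> (\<phi> ?q)) \<in> ball 0 1" by auto
  moreover have "\<psi> (\<phi> ?q) = ?q" using homeomorphism_apply1[OF W(3,4)] .
  moreover have "g ?q = z" using homeomorphism_apply1[OF h] z(1) by auto
  ultimately show False using z(1) by auto
qed

text \<open>The rim of a face lies in the skeleton and is infinite, while there are finitely many vertices.\<close>

lemma face_meets_open_edge:
  assumes "\<sigma> \<in> faces G"
  obtains e p where "e \<in> E" "p \<in> e - V" "p \<in> \<sigma>"
proof -
  obtain h g where h: "homeomorphism (cball (0::real^2) 1) \<sigma> h g" using face_disc assms .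
  have "infinite (sphere (0::real^2) 1)"
  proof -
    have "axis 1 1 \<in> sphere (0::real^2) 1" "- axis 1 1 \<in> sphere (0::real^2) 1" by auto
    moreover have "axis 1 1 \<noteq> - (axis 1 1 :: real^2)" by (simp add: vec_eq_iff axis_def)
    moreover have "connected (sphere (0::real^2) 1)" by (rule connected_sphere) simp
    ultimately show ?thesis
      using connected_finite_iff_sing[of "sphere (0::real^2) 1"] by (metis empty_iff singletonD)
  qed
  moreover have "inj_on h (sphere 0 1)"
    by (rule inj_on_inverseI[where g = g]) (use homeomorphism_apply1[OF h] in auto)
  ultimately have "infinite (h ` sphere 0 1)" using finite_imageD by blast
  then have "\<not> h ` sphere 0 1 \<subseteq> V" using finite_V finite_subset by blast
  then obtain p where p: "p \<in> h ` sphere 0 1" "p \<notin> V" by blast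
  then have "p \<in> \<Union>E" using face_rim_in_skeleton[OF assms h] by (auto simp: skeleton_def)
  moreover have "p \<in> \<sigma>" using p(1) homeomorphism_image1[OF h] sphere_cball by blast
  ultimately show thesis using that p(2) by blast
qed

text \<open>In a small chart about an interior point of a boundary edge the skeleton is the boundary line: that
  line lies in the edges, other edges stay away, and the edge itself lies in the boundary.  What remains
  of the chart is an open half-disc, which is connected and therefore lies in one component.  Its closure
  contains the neighbourhood.\<close>

lemma boundary_point_neighbourhood:
  assumes e: "e \<in> boundary_edges G" and p: "p \<in> e - V"
  obtains \<sigma> N where "\<sigma> \<in> faces G" "openin (top_of_set S) N" "p \<in> N" "N \<subseteq> \<sigma>"
proof -
  have eE: "e \<in> E" and eb: "e \<subseteq> surface_boundary S" using e by (auto simp: boundary_edges_def)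
  have pS: "p \<in> S" and po: "p \<in> - other_cells e"
    using p edge_in_S[OF eE] open_edge_eq[OF eE] by auto
  obtain W \<phi> \<psi> where W: "openin (top_of_set S) W" "openin (top_of_set half_plane) (\<phi> ` W)"
    "homeomorphism W (\<phi> ` W) \<phi> \<psi>" "p \<in> W"
    using smooth_surface_chart[OF smooth_S pS] .
  obtain N r where N: "openin (top_of_set S) N" "p \<in> N" "N \<subseteq> W \<inter> - other_cells e" "0 < r"
      "homeomorphism N (ball (\<phi> p) r \<inter> half_plane) \<phi> \<psi>"
    using chart_neighbourhood[OF W _ po] closed_other_cells by (metis open_Compl)
  define D where "D = ball (\<phi> p) r \<inter> half_plane"
  define D' where "D' = ball (\<phi> p) r \<inter> {x::real^2. 0 < x $ 2}"
  have "convex {x::real^2. 0 < x $ 2}"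
    using convex_halfspace_gt[of 0 "axis 2 1 :: real^2"] by (simp add: inner_axis')
  then have D': "D' \<subseteq> D" "open D'" "convex D'"
    unfolding D'_def D_def half_plane_def
    by (auto intro!: open_Int open_halfspace_component_gt_cart convex_Int)
  have DD': "D \<subseteq> closure D'"
    unfolding D_def D'_def half_plane_def
    using open_Int_closure_subset[OF open_ball, of "\<phi> p" r "{x::real^2. 0 < x $ 2}"] by simp
  have hN: "homeomorphism N D \<phi> \<psi>" using N(5) by (simp add: D_def)
  have P: "\<psi> ` D' \<subseteq> N" using D'(1) homeomorphism_image2[OF hN] by blast
  have NS: "N \<subseteq> S" using N(1) openin_imp_subset by blast
  have cont: "continuous_on D' \<psi>"
    using homeomorphism_cont2[OF hN] D'(1) by (rule continuous_on_subset)
  have "inj_on \<psi> D'"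
    by (rule inj_on_inverseI[where g = \<phi>]) (use homeomorphism_apply2[OF hN] D'(1) in auto)
  then have "\<psi> ` D' \<inter> surface_boundary S = {}"
    using planar_image_in_surface(2)[OF smooth_S D'(2) cont] P NS by blast
  then have Psub: "\<psi> ` D' \<subseteq> S - skeleton"
    using P NS N(3) eb skeleton_split[OF eE] by blast
  have "\<phi> p \<in> D" using N(2) homeomorphism_image1[OF hN] by blast
  then have "D' \<noteq> {}" using DD' by auto
  moreover have "connected (\<psi> ` D')"
    using cont D'(3) by (simp add: connected_continuous_image convex_connected)
  ultimately obtain C where C: "C \<in> components (S - skeleton)" "\<psi> ` D' \<subseteq> C"
    using exists_component_superset[OF Psub] Psub by blast
  have "N \<subseteq> closure (\<psi> ` D')"
  proof (rule ccontr)
    assume "\<not> N \<subseteq> closure (\<psi> ` D')"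
    then obtain y where y: "y \<in> D" "\<psi> y \<notin> closure (\<psi> ` D')"
      using homeomorphism_image2[OF hN] by blast
    have "openin (top_of_set D) (D \<inter> \<psi> -` (- closure (\<psi> ` D')))"
      by (rule continuous_openin_preimage_gen[OF homeomorphism_cont2[OF hN]
            open_Compl[OF closed_closure]])
    then obtain T where T: "open T" "D \<inter> \<psi> -` (- closure (\<psi> ` D')) = D \<inter> T"
      by (auto simp: openin_open)
    have "y \<in> T \<inter> closure D'" using y DD' T(2) by auto
    then obtain z where z: "z \<in> T" "z \<in> D'" using open_Int_closure_eq_empty[OF T(1)] by blast
    then have "\<psi> z \<notin> closure (\<psi> ` D')" using T(2) D'(1) by auto
    moreover have "\<psi> z \<in> closure (\<psi> ` D')"
      using z(2) by (intro closure_subset[THEN subsetD] imageI)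
    ultimately show False by blast
  qed
  also have "\<dots> \<subseteq> closure C" using C(2) by (rule closure_mono)
  finally show thesis using that[OF component_face[OF C(1)] N(1,2)] by blast
qed

text \<open>The two discs glued along the edge form an embedded planar domain, which is open in the surface.
  Thus the two faces leave no room for a third one.\<close>

lemma two_faces_neighbourhood:
  assumes eE: "e \<in> E" and \<sigma>: "\<sigma> \<in> faces G" "e \<in> face_edges G \<sigma>"
    and \<tau>: "\<tau> \<in> faces G" "e \<in> face_edges G \<tau>" and ne: "\<sigma> \<noteq> \<tau>" and p: "p \<in> e - V"
  obtains N where "openin (top_of_set S) N" "p \<in> N" "N \<subseteq> \<sigma> \<union> \<tau>"
proof -
  obtain h1 g1 where h1: "homeomorphism (cball (0::real^2) 1) \<sigma> h1 g1" using face_disc \<sigma>(1) .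
  obtain h2 g2 where h2: "homeomorphism (cball (0::real^2) 1) \<tau> h2 g2" using face_disc \<tau>(1) .
  have rim: "e \<subseteq> h1 ` sphere 0 1" "e \<subseteq> h2 ` sphere 0 1"
    using \<sigma>(2) \<tau>(2) disc_boundary_homeomorphism[OF h1] disc_boundary_homeomorphism[OF h2]
    by (auto simp: face_edges_def)
  define B where "B = sphere 0 1 \<inter> h1 -` (- other_cells e)"
  have "continuous_on (sphere 0 1) h1"
    using homeomorphism_cont1[OF h1] by (rule continuous_on_subset) auto
  then have oB: "openin (top_of_set (sphere 0 1)) B"
    unfolding B_def by (rule continuous_openin_preimage_gen) (simp add: closed_other_cells open_Compl)
  have "h1 ` B \<subseteq> e"
  proof (rule image_subsetI)
    fix z assume z: "z \<in> B"
    then have "h1 z \<in> skeleton" using face_rim_in_skeleton[OF \<sigma>(1) h1] by (auto simp: B_def)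
    moreover have "h1 z \<notin> other_cells e" using z by (simp add: B_def)
    ultimately show "h1 z \<in> e" using skeleton_split[OF eE] by simp
  qed
  then have hB: "h1 ` B \<subseteq> h2 ` sphere 0 1" using rim(2) by (rule subset_trans)
  obtain A k where A: "open A" "B \<subseteq> A" "continuous_on A k" "inj_on k A" "k ` A \<subseteq> \<sigma> \<union> \<tau>"
      "\<forall>z\<in>B. k z = h1 z"
    using glue_discs[OF h1 h2 face_interior_disjoint[OF \<tau>(1) \<sigma>(1) ne[symmetric] h2] oB hB] .
  have "k ` A \<subseteq> S" using A(5) face_in_S[OF \<sigma>(1)] face_in_S[OF \<tau>(1)] by blast
  then have op: "openin (top_of_set S) (k ` A)"
    using planar_image_in_surface(1)[OF smooth_S A(1,3,4)] by blast
  obtain z where "z \<in> sphere 0 1" "p = h1 z" using rim(1) p by blast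
  then have "z \<in> B" using p open_edge_eq[OF eE] by (auto simp: B_def)
  then have "p \<in> k ` A" using A(2,6) \<open>p = h1 z\<close> by (metis image_eqI subsetD)
  then show thesis using that[OF op _ A(5)] by blast
qed

lemma face_edge_subset:
  assumes "\<sigma> \<in> faces G" "e \<in> face_edges G \<sigma>"
  shows "e \<subseteq> \<sigma>"
proof -
  obtain h g where h: "homeomorphism (cball (0::real^2) 1) \<sigma> h g" using face_disc assms(1) .
  then show ?thesis
    using assms(2) disc_boundary_homeomorphism[OF h] homeomorphism_image1[OF h] sphere_cball
    unfolding face_edges_def by blast
qed

lemma interior_edge_faces:
  assumes e: "e \<in> E - boundary_edges G"
  obtains \<sigma> \<tau> where "\<sigma> \<noteq> \<tau>" "{\<rho> \<in> faces G. e \<in> face_edges G \<rho>} = {\<sigma>, \<tau>}"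
    "\<And>\<rho> p. \<rho> \<in> faces G \<Longrightarrow> p \<in> e - V \<Longrightarrow> p \<in> \<rho> \<Longrightarrow> \<rho> \<in> {\<sigma>, \<tau>}"
proof -
  have eE: "e \<in> E" and "\<not> e \<subseteq> surface_boundary S" using e by (auto simp: boundary_edges_def)
  then have "\<exists>\<sigma>\<in>faces G. \<exists>\<tau>\<in>faces G. \<sigma> \<noteq> \<tau> \<and> e \<in> face_edges G \<sigma> \<and> e \<in> face_edges G \<tau>"
    using G by (simp add: combinatorial_surface_def)
  then obtain \<sigma> \<tau> where \<sigma>: "\<sigma> \<in> faces G" "e \<in> face_edges G \<sigma>"
    and \<tau>: "\<tau> \<in> faces G" "e \<in> face_edges G \<tau>" and ne: "\<sigma> \<noteq> \<tau>"
    by blast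
  have *: "\<rho> \<in> {\<sigma>, \<tau>}" if \<rho>: "\<rho> \<in> faces G" "p \<in> e - V" "p \<in> \<rho>" for \<rho> p
  proof -
    obtain N where "openin (top_of_set S) N" "p \<in> N" "N \<subseteq> \<sigma> \<union> \<tau>"
      using two_faces_neighbourhood[OF eE \<sigma> \<tau> ne \<rho>(2)] .
    then show ?thesis using face_in_cover[of N p \<rho> "{\<sigma>, \<tau>}"] \<sigma>(1) \<tau>(1) \<rho> by auto
  qed
  obtain \<gamma> where "\<gamma> \<in> edge_params V e" using edge_param eE .
  then obtain q where "q \<in> e - V" using edge_interior(3) by blast
  then have eq: "{\<rho> \<in> faces G. e \<in> face_edges G \<rho>} = {\<sigma>, \<tau>}"
    using * face_edge_subset \<sigma> \<tau> by blast
  show thesis by (rule that[OF ne eq]) (rule *)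
qed

text \<open>The faces at an interior point of the edge are among its two faces.  Together with the counterpart
  for boundary edges this yields the finiteness of the set of faces.\<close>

lemma interior_edge_in_face:
  assumes "e \<in> E - boundary_edges G" "\<rho> \<in> faces G" "p \<in> e - V" "p \<in> \<rho>"
  shows "e \<in> face_edges G \<rho>"
proof (rule interior_edge_faces[OF assms(1)])
  fix \<sigma> \<tau>
  assume "{\<rho> \<in> faces G. e \<in> face_edges G \<rho>} = {\<sigma>, \<tau>}"
    and "\<And>\<rho> p. \<rho> \<in> faces G \<Longrightarrow> p \<in> e - V \<Longrightarrow> p \<in> \<rho> \<Longrightarrow> \<rho> \<in> {\<sigma>, \<tau>}"
  then have "\<rho> \<in> {\<rho> \<in> faces G. e \<in> face_edges G \<rho>}" using assms(2-4) by simp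
  then show ?thesis by simp
qed

text \<open>Near each of its points the open edge lies in a single face, so the points of the open edge in
  \<open>\<rho>\<close> form a clopen subset.  Boundary points of the surface cannot lie inside the disc, so the
  edge runs along the rim.\<close>

lemma boundary_edge_in_face:
  assumes e: "e \<in> boundary_edges G" and \<rho>: "\<rho> \<in> faces G" and p: "p \<in> e - V" "p \<in> \<rho>"
  shows "e \<in> face_edges G \<rho>"
proof -
  have eE: "e \<in> E" and eb: "e \<subseteq> surface_boundary S" using e by (auto simp: boundary_edges_def)
  obtain \<gamma> where \<gamma>: "\<gamma> \<in> edge_params V e" using edge_param eE .
  obtain h g where h: "homeomorphism (cball (0::real^2) 1) \<rho> h g" using face_disc \<rho> .
  have "compact \<rho>" using homeomorphism_image1[OF h] homeomorphism_cont1[OF h]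
    by (metis compact_cball compact_continuous_image)
  then have "closedin (top_of_set (e - V)) ((e - V) \<inter> \<rho>)"
    by (simp add: closedin_closed_Int compact_imp_closed)
  moreover have "openin (top_of_set (e - V)) ((e - V) \<inter> \<rho>)"
  proof (subst openin_subopen, intro ballI)
    fix x assume x: "x \<in> (e - V) \<inter> \<rho>"
    obtain \<sigma> N where N: "\<sigma> \<in> faces G" "openin (top_of_set S) N" "x \<in> N" "N \<subseteq> \<sigma>"
      using boundary_point_neighbourhood[OF e] x by blast
    have "\<rho> = \<sigma>" using face_in_cover[OF N(2,3) \<rho>, of "{\<sigma>}"] x N(1,4) by auto
    obtain T where T: "open T" "N = S \<inter> T" using N(2) by (auto simp: openin_open)
    have "openin (top_of_set (e - V)) ((e - V) \<inter> T)" using T(1) by (simp add: openin_open_Int)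
    moreover have "(e - V) \<inter> T \<subseteq> (e - V) \<inter> \<rho>"
      using T(2) N(4) \<open>\<rho> = \<sigma>\<close> edge_in_S[OF eE] by auto
    ultimately show "\<exists>U. openin (top_of_set (e - V)) U \<and> x \<in> U \<and> U \<subseteq> (e - V) \<inter> \<rho>"
      using x T(2) N(3) by blast
  qed
  ultimately have "e - V \<subseteq> \<rho>"
    using edge_interior(1)[OF \<gamma>] p unfolding connected_clopen by blast
  moreover have "h ` cball 0 1 = h ` ball 0 1 \<union> h ` sphere 0 1"
    by (metis image_Un sup_commute cball_diff_sphere Un_Diff_cancel sphere_cball subset_Un_eq)
  ultimately have "e - V \<subseteq> h ` sphere 0 1"
    using face_interior(2)[OF \<rho> h] eb homeomorphism_image1[OF h] by blast
  moreover have "continuous_on (sphere 0 1) h"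
    using homeomorphism_cont1[OF h] by (rule continuous_on_subset) auto
  then have "closed (h ` sphere 0 1)"
    by (simp add: compact_continuous_image compact_imp_closed)
  ultimately have "e \<subseteq> h ` sphere 0 1"
    using edge_interior(2)[OF \<gamma>] closure_minimal by blast
  then show ?thesis using eE disc_boundary_homeomorphism[OF h] by (simp add: face_edges_def)
qed

lemma boundary_edge_face:
  assumes e: "e \<in> boundary_edges G"
  obtains \<sigma> where "{\<rho> \<in> faces G. e \<in> face_edges G \<rho>} = {\<sigma>}"
proof -
  have "e \<in> E" using e by (auto simp: boundary_edges_def)
  then obtain \<gamma> where "\<gamma> \<in> edge_params V e" using edge_param by blast
  then obtain q where q: "q \<in> e - V" using edge_interior(3) by blast
  obtain \<sigma> N where N: "\<sigma> \<in> faces G" "openin (top_of_set S) N" "q \<in> N" "N \<subseteq> \<sigma>"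
    using boundary_point_neighbourhood[OF e q] .
  have \<sigma>: "e \<in> face_edges G \<sigma>"
    by (rule boundary_edge_in_face[OF e N(1) q subsetD[OF N(4,3)]])
  have uniq: "\<rho> = \<sigma>" if "\<rho> \<in> faces G" "e \<in> face_edges G \<rho>" for \<rho>
  proof -
    have "q \<in> \<rho>" using face_edge_subset[OF that] q by auto
    then show ?thesis using face_in_cover[OF N(2,3), of \<rho> "{\<sigma>}"] that(1) N(1,4) by simp
  qed
  show thesis
  proof (rule that, rule set_eqI, rule iffI)
    fix \<rho> assume "\<rho> \<in> {\<rho> \<in> faces G. e \<in> face_edges G \<rho>}"
    then show "\<rho> \<in> {\<sigma>}" using uniq by (metis CollectD singletonI)
  next
    fix \<rho> assume "\<rho> \<in> {\<sigma>}"
    then show "\<rho> \<in> {\<rho> \<in> faces G. e \<in> face_edges G \<rho>}" using N(1) \<sigma> by simp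
  qed
qed

text \<open>Every face touches an open edge and so has that edge on its rim, and each of the finitely many
  edges is on the rim of at most two faces.\<close>

lemma finite_faces: "finite (faces G)"
proof -
  have "finite {\<rho> \<in> faces G. e \<in> face_edges G \<rho>}" if "e \<in> E" for e
  proof (cases "e \<in> boundary_edges G")
    case True
    then obtain \<sigma> where "{\<rho> \<in> faces G. e \<in> face_edges G \<rho>} = {\<sigma>}"
      by (rule boundary_edge_face)
    then show ?thesis by simp
  next
    case False
    then have "e \<in> E - boundary_edges G" using that by simp
    then obtain \<sigma> \<tau> where "{\<rho> \<in> faces G. e \<in> face_edges G \<rho>} = {\<sigma>, \<tau>}"
      by (rule interior_edge_faces)
    then show ?thesis by simp
  qed
  then have "finite (\<Union>e\<in>E. {\<rho> \<in> faces G. e \<in> face_edges G \<rho>})" using finite_E by blast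
  moreover have "faces G \<subseteq> (\<Union>e\<in>E. {\<rho> \<in> faces G. e \<in> face_edges G \<rho>})"
  proof
    fix \<sigma> assume \<sigma>: "\<sigma> \<in> faces G"
    then obtain e p where e: "e \<in> E" "p \<in> e - V" "p \<in> \<sigma>" by (rule face_meets_open_edge)
    have "e \<in> face_edges G \<sigma>"
    proof (cases "e \<in> boundary_edges G")
      case True
      then show ?thesis by (rule boundary_edge_in_face[OF _ \<sigma> e(2,3)])
    next
      case False
      then have "e \<in> E - boundary_edges G" using e(1) by simp
      then show ?thesis by (rule interior_edge_in_face[OF _ \<sigma> e(2,3)])
    qed
    then show "\<sigma> \<in> (\<Union>e\<in>E. {\<rho> \<in> faces G. e \<in> face_edges G \<rho>})" using \<sigma> e(1) by blast
  qed
  ultimately show ?thesis using finite_subset by blast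
qed

end

section \<open>The boundary integral as a sum over faces\<close>

lemma cvf_integral_orient_edges:
  "cvf_integral (orient_edges \<theta> A) F = (\<Sum>e\<in>A. edge_sign (e, \<theta> e) F * cvf_val F e)"
  unfolding cvf_integral_def orient_edges_def by (subst sum.reindex) (auto simp: inj_on_def)

theorem mainTheorem3:
  fixes G :: "'a::euclidean_space surface_graph"
    and \<omega> :: "'a set \<Rightarrow> 'a set \<Rightarrow> 'a edge_orientation"
    and F :: "'a cvf"
  assumes "combinatorial_surface G"
    and "surface_orientation G \<omega>"
    and "is_cvf G F"
  shows "cvf_integral (orient_edges (boundary_orientation G \<omega>) (boundary_edges G)) F
    = face_integral G (whirl G \<omega> F)"
proof -
  interpret comb_surface G by unfold_locales (rule assms(1))
  define t where "t \<sigma> e = edge_sign (e, \<omega> \<sigma> e) F * cvf_val F e" for \<sigma> e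
  define adj where "adj e = {\<sigma> \<in> faces G. e \<in> face_edges G \<sigma>}" for e
  have interior: "(\<Sum>\<sigma>\<in>adj e. t \<sigma> e) = 0" if e: "e \<in> E - boundary_edges G" for e
  proof -
    obtain \<sigma> \<tau> where st: "\<sigma> \<noteq> \<tau>" "adj e = {\<sigma>, \<tau>}"
      unfolding adj_def by (rule interior_edge_faces[OF e])
    have "\<sigma> \<in> adj e" "\<tau> \<in> adj e" using st(2) by simp_all
    then have f: "\<sigma> \<in> faces G" "e \<in> face_edges G \<sigma>" "\<tau> \<in> faces G" "e \<in> face_edges G \<tau>"
      by (simp_all add: adj_def)
    have "\<omega> \<sigma> e = opposite (\<omega> \<tau> e)"
      using assms(2) f st(1) unfolding surface_orientation_def by (metis IntI)
    moreover have "\<omega> \<tau> e \<in> edge_orientations V e"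
      using assms(2) f unfolding surface_orientation_def face_orientation_def by metis
    moreover have "cvf_orient F e \<in> edge_orientations V e"
      using assms(3) e by (auto simp: is_cvf_def)
    ultimately have "edge_sign (e, \<omega> \<sigma> e) F = - edge_sign (e, \<omega> \<tau> e) F"
      using edge_sign_opposite by metis
    then show ?thesis using st by (simp add: t_def)
  qed
  have boundary: "(\<Sum>\<sigma>\<in>adj e. t \<sigma> e) = edge_sign (e, boundary_orientation G \<omega> e) F * cvf_val F e"
    if e: "e \<in> boundary_edges G" for e
  proof -
    obtain \<sigma> where \<sigma>: "adj e = {\<sigma>}" unfolding adj_def by (rule boundary_edge_face[OF e])
    have "(THE \<sigma>. \<sigma> \<in> faces G \<and> e \<in> face_edges G \<sigma>) = (THE \<sigma>. \<sigma> \<in> adj e)"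
      by (simp add: adj_def)
    also have "\<dots> = \<sigma>" using \<sigma> by simp
    finally show ?thesis using \<sigma> by (simp add: t_def boundary_orientation_def)
  qed
  have "face_integral G (whirl G \<omega> F) = (\<Sum>\<sigma>\<in>faces G. \<Sum>e | e \<in> E \<and> e \<in> face_edges G \<sigma>. t \<sigma> e)"
    unfolding face_integral_def whirl_def cvf_integral_orient_edges t_def
    by (intro sum.cong) (auto simp: face_edges_def)
  also have "\<dots> = (\<Sum>e\<in>E. \<Sum>\<sigma>\<in>adj e. t \<sigma> e)"
    unfolding adj_def by (rule sum.swap_restrict[OF finite_faces finite_E])
  also have "\<dots> = (\<Sum>e\<in>boundary_edges G. \<Sum>\<sigma>\<in>adj e. t \<sigma> e)"
    using interior finite_E
    by (intro sum.mono_neutral_right) (auto simp: boundary_edges_def)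
  also have "\<dots> = cvf_integral (orient_edges (boundary_orientation G \<omega>) (boundary_edges G)) F"
    unfolding cvf_integral_orient_edges by (rule sum.cong[OF refl boundary])
  finally show ?thesis by simp
qed

end
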